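(* Let $(\mathcal L,\vee,\wedge)$ be a finite distributive lattice, let $\ell\ge 1$, let $\mathbf q=(q_1,\dots,q_\ell)$ be variables, and let $r_1,\dots,r_\ell:\mathcal L\to\mathbb N$ be modular functions, i.e. $r_i(x)+r_i(y)=r_i(x\vee y)+r_i(x\wedge y)$ for all $x,y\in\mathcal L$ and $1\le i\le\ell$; write $\mathbf r=(r_1,\dots,r_\ell)$. Let $\alpha,\beta,\gamma,\delta:\mathcal L\to\mathbb R_{+}$ be nonnegative functions such that $$\alpha(x)\cdot\beta(y)\ \le\ \gamma(x\vee y)\cdot\delta(x\wedge y)\qquad\text{for all }x,y\in\mathcal L.$$ Then, for all $X,Y\subseteq\mathcal L$, $$\alpha_{\langle\mathbf q,\mathbf r\rangle}(X)\cdot\beta_{\langle\mathbf q,\mathbf r\rangle}(Y)\ \leqslant_{\mathbf q}\ \gamma_{\langle\mathbf q,\mathbf r\rangle}(X\vee Y)\cdot\delta_{\langle\mathbf q,\mathbf r\rangle}(X\wedge Y).$$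
   Context: $\mathbb N=\{0,1,2,\dots\}$ and $\mathbb R_+=[0,\infty)$. Here $\vee$ is the least upper bound and $\wedge$ the greatest lower bound. For $\rho:\mathcal L\to\mathbb R_+$ and $X\subseteq\mathcal L$, $$\rho_{\langle\mathbf q,\mathbf r\rangle}(X):=\sum_{x\in X}\rho(x)\,q_1^{r_1(x)}\cdots q_\ell^{r_\ell(x)}\in\mathbb R_+[q_1,\dots,q_\ell].$$ For $X,Y\subseteq\mathcal L$, $X\vee Y:=\{x\vee y: x\in X,\,y\in Y\}$ and $X\wedge Y:=\{x\wedge y: x\in X,\,y\in Y\}$. For $F,G\in\mathbb R[q_1,\dots,q_\ell]$, $F\leqslant_{\mathbf q}G$ means that all coefficients of $G-F$ are nonnegative. *)

theory Defs
  imports Complex_Main "HOL-Library.Poly_Mapping"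
begin

text \<open>
  Multivariate polynomials over the reals are finitely supported maps from exponent vectors
  to coefficients; the product of \<^theory>\<open>HOL-Library.Poly_Mapping\<close> is the usual convolution.
  The variables are indexed by a type \<open>'l\<close>. For \<open>'l\<close> finite with \<open>\<ell> = CARD('l)\<close> elements
  (so \<open>\<ell> \<ge> 1\<close>) this is exactly the polynomial ring in \<open>\<ell>\<close> variables.
\<close>

type_synonym 'l rpoly = "('l \<Rightarrow>\<^sub>0 nat) \<Rightarrow>\<^sub>0 real"

definition const_poly :: "real \<Rightarrow> 'l rpoly" where
  "const_poly c = Poly_Mapping.single 0 c"

definition qvar :: "'l \<Rightarrow> 'l rpoly" where
  "qvar i = Poly_Mapping.single (Poly_Mapping.single i 1) 1"

definition modular_fun :: "('a::lattice \<Rightarrow> nat) \<Rightarrow> bool" where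
  "modular_fun f \<longleftrightarrow> (\<forall>x y. f x + f y = f (sup x y) + f (inf x y))"

definition q_sum :: "('l::finite \<Rightarrow> 'a \<Rightarrow> nat) \<Rightarrow> ('a::finite \<Rightarrow> real) \<Rightarrow> 'a set \<Rightarrow> 'l rpoly" where
  "q_sum r \<rho> X = (\<Sum>x\<in>X. const_poly (\<rho> x) * (\<Prod>i\<in>UNIV. qvar i ^ r i x))"

definition set_sup :: "'a::lattice set \<Rightarrow> 'a set \<Rightarrow> 'a set" where
  "set_sup X Y = {sup x y | x y. x \<in> X \<and> y \<in> Y}"

definition set_inf :: "'a::lattice set \<Rightarrow> 'a set \<Rightarrow> 'a set" where
  "set_inf X Y = {inf x y | x y. x \<in> X \<and> y \<in> Y}"

definition coeff_le :: "'l rpoly \<Rightarrow> 'l rpoly \<Rightarrow> bool"  (infix "\<le>\<^sub>q" 50) where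
  "F \<le>\<^sub>q G \<longleftrightarrow> (\<forall>m. 0 \<le> Poly_Mapping.lookup (G - F) m)"

end

theory Submission
  imports Defs
begin

text \<open>
  Comparing coefficients of a fixed monomial, the claim says that the sum of
  \<open>\<alpha> x * \<beta> y\<close> over the pairs \<open>(x, y)\<close> with a prescribed total exponent
  \<open>r x + r y\<close> is at most the corresponding sum of \<open>\<gamma> z * \<delta> w\<close>.  Restricting the functions to
  \<open>X\<close>, \<open>Y\<close> and their joins and meets by putting them to zero elsewhere preserves the four
  functions condition, so all sums may range over the whole lattice.

  Modularity makes \<open>r x + r y\<close> a function of \<open>x \<squnion> y\<close> and \<open>x \<sqinter> y\<close>.  Hence it is enough to prove
  the inequality separately on each set of pairs with fixed join \<open>u\<close> and fixed meet \<open>v\<close>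
  (\<open>four_functions_relative_complements\<close>): these are the pairs of mutual complements in
  the interval \<open>[v, u]\<close>.  There, let \<open>f x = \<alpha> x * \<beta> x'\<close> with \<open>x'\<close> the complement of \<open>x\<close>, and let
  \<open>h z = \<gamma> z * \<delta> z'\<close>.  By De Morgan,
  \<open>f x * f y' \<le> h (x \<squnion> y) * h ((x \<sqinter> y)')\<close>, because \<open>\<alpha> x * \<beta> y\<close> and \<open>\<alpha> y' * \<beta> x'\<close> can both be
  estimated by the hypothesis.  The classical four functions theorem of Ahlswede and Daykin
  (\<open>four_functions\<close>) now bounds the square of the sum of \<open>f\<close> by the square of the sum of \<open>h\<close>,
  since complementation permutes the summands.

  The classical theorem is proved for finite sublattices of a distributive lattice without
  representing them by sets: an element \<open>c\<close> that is neither least nor greatest embeds the lattice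
  into the product of two strictly smaller ones by \<open>x \<mapsto> (x \<sqinter> c, x \<squnion> c)\<close>, and the property
  is inherited by products and sublattices.  This leaves chains of at most two elements.
\<close>

section \<open>The four functions theorem\<close>

text \<open>
  After expansion, \<open>a0 * b0\<close> and \<open>a1 * b1\<close> are bounded by separate terms on the right, whereas
  \<open>p = a0 * b1\<close> and \<open>q = a1 * b0\<close> share the bound \<open>t = c1 * d0\<close>.  But \<open>p * q \<le> t * (c0 * d1)\<close>.  The claim \<open>p + q \<le> t + c0 * d1\<close>
  then comes from \<open>(t - p) * (t - q) \<ge> 0\<close> after division by \<open>t\<close>, and is trivial if \<open>t = 0\<close>.
\<close>

lemma four_functions_two_chain:
  fixes a0 a1 b0 b1 c0 c1 d0 d1 :: real
  assumes nonneg: "0 \<le> a0" "0 \<le> a1" "0 \<le> b0" "0 \<le> b1" "0 \<le> c0" "0 \<le> c1" "0 \<le> d0" "0 \<le> d1"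
    and le: "a0 * b0 \<le> c0 * d0" "a0 * b1 \<le> c1 * d0" "a1 * b0 \<le> c1 * d0" "a1 * b1 \<le> c1 * d1"
  shows "(a0 + a1) * (b0 + b1) \<le> (c0 + c1) * (d0 + d1)"
proof -
  define p q t where "p = a0 * b1" and "q = a1 * b0" and "t = c1 * d0"
  have pq: "0 \<le> p" "0 \<le> q" "p \<le> t" "q \<le> t"
    using nonneg le by (auto simp: p_def q_def t_def)
  have "p + q \<le> t + c0 * d1"
  proof (cases "t = 0")
    case True
    then show ?thesis using pq nonneg by simp
  next
    case False
    then have t: "0 < t" using pq by linarith
    have "p * q = (a0 * b0) * (a1 * b1)"
      by (simp add: p_def q_def)
    also have "\<dots> \<le> (c0 * d0) * (c1 * d1)"
      using nonneg by (intro mult_mono[OF le(1) le(4)]) auto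
    also have "\<dots> = t * (c0 * d1)"
      by (simp add: t_def)
    finally have "p * q \<le> t * (c0 * d1)" .
    moreover have "0 \<le> (t - p) * (t - q)"
      using pq by simp
    ultimately have "t * (p + q) \<le> t * (t + c0 * d1)"
      by (simp add: algebra_simps)
    then show ?thesis using t by simp
  qed
  then show ?thesis
    using le by (simp add: p_def q_def t_def algebra_simps)
qed

lemma sublattice_without_middle_element:
  fixes S :: "'a::lattice set"
  assumes extreme: "\<And>c. c \<in> S \<Longrightarrow> (\<forall>s\<in>S. s \<le> c) \<or> (\<forall>s\<in>S. c \<le> s)"
  obtains "S = {}" | a where "S = {a}" | a b where "a < b" "S = {a, b}"
proof -
  consider "S = {}" | t where "t \<in> S" "\<forall>s\<in>S. \<forall>s'\<in>S. s' \<le> s"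
    | b where "b \<in> S" "\<forall>s\<in>S. b \<le> s" "\<exists>s\<in>S. \<not> s \<le> b"
    using extreme by (metis all_not_in_conv)
  then show thesis
  proof cases
    case 1
    then show ?thesis using that by blast
  next
    case 2
    then have "S = {t}" by (auto intro: antisym)
    then show ?thesis using that by blast
  next
    case 3
    then obtain t where t: "t \<in> S" "\<not> t \<le> b" by blast
    then have tt: "\<forall>s\<in>S. s \<le> t"
      using extreme 3 by blast
    have "s = b \<or> s = t" if "s \<in> S" for s
      using extreme[OF that] that t tt 3 by (meson antisym)
    then have "S = {b, t}" using t 3 by blast
    moreover have "b < t" using 3 t by (simp add: less_le_not_le)
    ultimately show ?thesis using that by blast
  qed
qed

text \<open>
  This cancellation law makes \<open>x \<mapsto> (x \<sqinter> c, x \<squnion> c)\<close> an embedding; equivalently, relative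
  complements are unique.
\<close>

lemma distrib_lattice_cancel:
  fixes x y c :: "'a::distrib_lattice"
  assumes "inf x c = inf y c" and "sup x c = sup y c"
  shows "x = y"
  using assms by (metis inf_sup_absorb inf_sup_distrib1 inf_commute sup_commute)

text \<open>
  For the induction step, the sum over \<open>S\<close> is grouped first by \<open>p = x \<sqinter> c\<close>
  and then by \<open>s = x \<squnion> c\<close>.  The induction hypothesis for the elements \<open>x \<squnion> c\<close> yields the four
  functions condition for the sums over fixed \<open>p\<close>, to which the induction hypothesis for the
  elements \<open>x \<sqinter> c\<close> applies.
\<close>

theorem four_functions:
  fixes S :: "'a::distrib_lattice set" and \<alpha> \<beta> \<gamma> \<delta> :: "'a \<Rightarrow> real"
  assumes "finite S"
    and "\<And>x y. x \<in> S \<Longrightarrow> y \<in> S \<Longrightarrow> sup x y \<in> S \<and> inf x y \<in> S"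
    and "\<And>x. x \<in> S \<Longrightarrow> 0 \<le> \<alpha> x" and "\<And>x. x \<in> S \<Longrightarrow> 0 \<le> \<beta> x"
    and "\<And>x. x \<in> S \<Longrightarrow> 0 \<le> \<gamma> x" and "\<And>x. x \<in> S \<Longrightarrow> 0 \<le> \<delta> x"
    and "\<And>x y. x \<in> S \<Longrightarrow> y \<in> S \<Longrightarrow> \<alpha> x * \<beta> y \<le> \<gamma> (sup x y) * \<delta> (inf x y)"
  shows "sum \<alpha> S * sum \<beta> S \<le> sum \<gamma> S * sum \<delta> S"
  using assms
proof (induction "card S" arbitrary: S \<alpha> \<beta> \<gamma> \<delta> rule: less_induct)
  case less
  note fin = less.prems(1) and closed = less.prems(2) and nonneg = less.prems(3-6)
    and le = less.prems(7)
  show ?case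
  proof (cases "\<exists>c\<in>S. (\<exists>s\<in>S. \<not> s \<le> c) \<and> (\<exists>s\<in>S. \<not> c \<le> s)")
    case False
    then have "(\<forall>s\<in>S. s \<le> c) \<or> (\<forall>s\<in>S. c \<le> s)" if "c \<in> S" for c
      using that by blast
    then show ?thesis
    proof (rule sublattice_without_middle_element)
      assume "S = {}"
      then show ?thesis by simp
    next
      fix a assume "S = {a}"
      then show ?thesis using le[of a a] by simp
    next
      fix a b assume ab: "a < b" "S = {a, b}"
      then have "sup a b = b" "sup b a = b" "inf a b = a" "inf b a = a"
        by (simp_all add: sup_absorb1 sup_absorb2 inf_absorb1 inf_absorb2)
      then show ?thesis
        using ab nonneg le[of a a] le[of a b] le[of b a] le[of b b]
        by (simp add: four_functions_two_chain)
    qed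
  next
    case True
    then obtain c where c: "c \<in> S" "\<exists>s\<in>S. \<not> s \<le> c" "\<exists>s\<in>S. \<not> c \<le> s"
      by blast
    define S1 where "S1 = (\<lambda>x. inf x c) ` S"
    define S2 where "S2 = (\<lambda>x. sup x c) ` S"
    have "S1 \<subseteq> S" "S2 \<subseteq> S"
      using c closed by (auto simp: S1_def S2_def)
    moreover have "\<forall>s\<in>S1. s \<le> c" "\<forall>s\<in>S2. c \<le> s"
      by (auto simp: S1_def S2_def)
    ultimately have "S1 \<subset> S" "S2 \<subset> S"
      using c by blast+
    then have card: "card S1 < card S" "card S2 < card S"
      using fin by (simp_all add: psubset_card_mono)
    have fin12: "finite S1" "finite S2"
      using fin by (simp_all add: S1_def S2_def)
    have inf_sup: "inf (sup x y) c = sup (inf x c) (inf y c)"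
      and sup_inf: "sup (inf x y) c = inf (sup x c) (sup y c)" for x y
      by (fact inf_sup_distrib2 sup_inf_distrib2)+
    have inf_inf: "inf (inf x y) c = inf (inf x c) (inf y c)"
      and sup_sup: "sup (sup x y) c = sup (sup x c) (sup y c)" for x y
      by (simp_all add: inf_aci sup_aci)
    have closed1: "sup p p' \<in> S1 \<and> inf p p' \<in> S1" if "p \<in> S1" "p' \<in> S1" for p p'
    proof -
      from that obtain x y where "x \<in> S" "y \<in> S" "p = inf x c" "p' = inf y c"
        by (auto simp: S1_def)
      then show ?thesis
        using closed unfolding S1_def by (metis image_eqI inf_inf inf_sup)
    qed
    have closed2: "sup s s' \<in> S2 \<and> inf s s' \<in> S2" if "s \<in> S2" "s' \<in> S2" for s s'
    proof -
      from that obtain x y where "x \<in> S" "y \<in> S" "s = sup x c" "s' = sup y c"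
        by (auto simp: S2_def)
      then show ?thesis
        using closed unfolding S2_def by (metis image_eqI sup_inf sup_sup)
    qed
    \<comment> \<open>These fibres of the embedding have at most one element; sums over them extend the
      four functions by zero from the image of the embedding to the whole product.\<close>
    define E where "E p s = {x \<in> S. inf x c = p \<and> sup x c = s}" for p s
    define row where "row \<rho> p = (\<Sum>s\<in>S2. sum \<rho> (E p s))" for \<rho> :: "'a \<Rightarrow> real" and p
    have finE: "finite (E p s)" for p s
      using fin by (simp add: E_def)
    have single: "E p s = {x}" if "x \<in> E p s" for p s x
      using that by (auto simp: E_def intro: distrib_lattice_cancel)
    have row_eq: "row \<rho> p = sum \<rho> {x \<in> S. inf x c = p}" for \<rho> p
    proof -
      have "row \<rho> p = (\<Sum>s\<in>S2. sum \<rho> {x \<in> {x \<in> S. inf x c = p}. sup x c = s})"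
        by (simp add: row_def E_def conj_ac)
      also have "\<dots> = sum \<rho> {x \<in> S. inf x c = p}"
        using fin fin12 by (intro sum.group) (auto simp: S2_def)
      finally show ?thesis .
    qed
    have total: "sum (row \<rho>) S1 = sum \<rho> S" for \<rho>
      unfolding row_eq using fin fin12 by (intro sum.group) (auto simp: S1_def)
    have sumE_nonneg: "0 \<le> sum \<rho> (E p s)" if "\<And>x. x \<in> S \<Longrightarrow> 0 \<le> \<rho> x" for \<rho> :: "'a \<Rightarrow> real" and p s
      using that by (auto simp: E_def intro: sum_nonneg)
    have row_nonneg: "0 \<le> row \<rho> p" if "\<And>x. x \<in> S \<Longrightarrow> 0 \<le> \<rho> x" for \<rho> p
      using that by (auto simp: row_def intro!: sum_nonneg sumE_nonneg)
    have cell: "sum \<alpha> (E p s) * sum \<beta> (E p' s')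
        \<le> sum \<gamma> (E (sup p p') (sup s s')) * sum \<delta> (E (inf p p') (inf s s'))" for p p' s s'
    proof (cases "E p s = {} \<or> E p' s' = {}")
      case True
      then show ?thesis
        using sumE_nonneg[OF nonneg(3)] sumE_nonneg[OF nonneg(4)] by auto
    next
      case False
      then obtain x y where xy: "x \<in> E p s" "y \<in> E p' s'" by blast
      then have "sup x y \<in> E (sup p p') (sup s s')" "inf x y \<in> E (inf p p') (inf s s')"
        using closed unfolding E_def by (auto simp: inf_sup inf_inf sup_inf sup_sup)
      then show ?thesis
        using xy le by (simp add: single) (simp add: E_def)
    qed
    have "sum (row \<alpha>) S1 * sum (row \<beta>) S1 \<le> sum (row \<gamma>) S1 * sum (row \<delta>) S1"
    proof (rule less.hyps[OF card(1) fin12(1) closed1])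
      fix p p'
      show "row \<alpha> p * row \<beta> p' \<le> row \<gamma> (sup p p') * row \<delta> (inf p p')"
        unfolding row_def
        by (rule less.hyps[OF card(2) fin12(2) closed2]) (auto intro!: sumE_nonneg nonneg cell)
    qed (auto intro!: row_nonneg nonneg)
    then show ?thesis by (simp only: total)
  qed
qed

section \<open>Pairs with prescribed join and meet\<close>

lemma relative_complement_sup_inf:
  fixes x y x' y' :: "'a::distrib_lattice"
  assumes "sup x x' = u" "inf x x' = v" "sup y y' = u" "inf y y' = v"
  shows "sup (sup x y) (inf x' y') = u" and "inf (sup x y) (inf x' y') = v"
proof -
  have bounds: "x \<le> u" "y \<le> u" "v \<le> x'" "v \<le> y'"
    using assms by (metis sup_ge1 sup_ge2 inf_le1 inf_le2)+
  have "sup (sup x y) (inf x' y') = inf (sup (sup x x') y) (sup x (sup y y'))"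
    by (subst sup_inf_distrib1) (simp add: sup_aci)
  then show "sup (sup x y) (inf x' y') = u"
    using assms bounds by (simp add: sup_absorb1 sup_absorb2)
  have "inf (sup x y) (inf x' y') = sup (inf (inf x x') y') (inf x' (inf y y'))"
    by (subst inf_sup_distrib2) (simp add: inf_aci)
  then show "inf (sup x y) (inf x' y') = v"
    using assms bounds by (simp add: inf_absorb1 inf_absorb2)
qed

text \<open>
  Applied to one pair of sets and their complements in a power set, this is the argument that
  deduces the Marica--Schoenheim theorem on set differences from the four functions theorem.
  The same double sum is written once as a sum over its first and once as a sum over its second
  component; the four functions theorem for these two marginals bounds its square.
\<close>

theorem four_functions_relative_complements:
  fixes \<alpha> \<beta> \<gamma> \<delta> :: "'a::{finite, distrib_lattice} \<Rightarrow> real" and u v :: 'a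
  assumes nonneg: "\<And>x. 0 \<le> \<alpha> x" "\<And>x. 0 \<le> \<beta> x" "\<And>x. 0 \<le> \<gamma> x" "\<And>x. 0 \<le> \<delta> x"
    and le: "\<And>x y. \<alpha> x * \<beta> y \<le> \<gamma> (sup x y) * \<delta> (inf x y)"
  shows "(\<Sum>(x, y) | sup x y = u \<and> inf x y = v. \<alpha> x * \<beta> y)
       \<le> (\<Sum>(x, y) | sup x y = u \<and> inf x y = v. \<gamma> x * \<delta> y)"
proof -
  define C where "C x = {y. sup x y = u \<and> inf x y = v}" for x
  have C_sym: "x \<in> C y \<longleftrightarrow> y \<in> C x" for x y
    by (simp add: C_def sup_commute inf_commute)
  have single: "C x = {y}" if "y \<in> C x" for x y
  proof -
    have "z = y" if "z \<in> C x" for z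
      using that \<open>y \<in> C x\<close>
      by (intro distrib_lattice_cancel[of z x y]) (simp_all add: C_def sup_commute inf_commute)
    then show ?thesis using \<open>y \<in> C x\<close> by blast
  qed
  define F where "F \<rho> \<sigma> x = (\<Sum>y\<in>C x. \<rho> x * \<sigma> y)" for \<rho> \<sigma> :: "'a \<Rightarrow> real" and x
  have pairs: "{(x, y). sup x y = u \<and> inf x y = v} = Sigma UNIV C"
    by (auto simp: C_def)
  have first: "(\<Sum>(x, y) | sup x y = u \<and> inf x y = v. \<rho> x * \<sigma> y) = sum (F \<rho> \<sigma>) UNIV" for \<rho> \<sigma>
    unfolding pairs F_def by (rule sum.Sigma[symmetric]) auto
  have swap: "sum (F \<sigma> \<rho>) UNIV = sum (F \<rho> \<sigma>) UNIV" for \<rho> \<sigma>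
  proof -
    have "sum (F \<sigma> \<rho>) UNIV = (\<Sum>y\<in>UNIV. \<Sum>x | x \<in> UNIV \<and> x \<in> C y. \<rho> x * \<sigma> y)"
      by (simp add: F_def mult.commute)
    also have "\<dots> = (\<Sum>x\<in>UNIV. \<Sum>y | y \<in> UNIV \<and> x \<in> C y. \<rho> x * \<sigma> y)"
      by (rule sum.swap_restrict) auto
    also have "\<dots> = sum (F \<rho> \<sigma>) UNIV"
      unfolding F_def by (intro sum.cong refl) (auto simp: C_sym)
    finally show ?thesis .
  qed
  have F_nonneg: "0 \<le> F \<rho> \<sigma> x" if "\<And>x. 0 \<le> \<rho> x" "\<And>x. 0 \<le> \<sigma> x" for \<rho> \<sigma> x
    using that by (auto simp: F_def intro!: sum_nonneg)
  have "sum (F \<alpha> \<beta>) UNIV * sum (F \<beta> \<alpha>) UNIV \<le> sum (F \<gamma> \<delta>) UNIV * sum (F \<delta> \<gamma>) UNIV"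
  proof (rule four_functions)
    fix x y
    show "F \<alpha> \<beta> x * F \<beta> \<alpha> y \<le> F \<gamma> \<delta> (sup x y) * F \<delta> \<gamma> (inf x y)"
    proof (cases "C x = {} \<or> C y = {}")
      case True
      then show ?thesis
        using F_nonneg[of \<gamma> \<delta> "sup x y"] F_nonneg[of \<delta> \<gamma> "inf x y"] nonneg by (auto simp: F_def)
    next
      case False
      then obtain x' y' where C: "x' \<in> C x" "y' \<in> C y" by blast
      have "inf x' y' \<in> C (sup x y)"
        using C relative_complement_sup_inf[of x x' u v y y'] by (simp add: C_def)
      moreover have "sup x' y' \<in> C (inf x y)"
        using C relative_complement_sup_inf[of x' x u v y' y]
        by (simp add: C_def sup_commute inf_commute)
      ultimately have "F \<gamma> \<delta> (sup x y) = \<gamma> (sup x y) * \<delta> (inf x' y')"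
        "F \<delta> \<gamma> (inf x y) = \<delta> (inf x y) * \<gamma> (sup x' y')"
        by (simp_all add: F_def single)
      moreover have "F \<alpha> \<beta> x = \<alpha> x * \<beta> x'" "F \<beta> \<alpha> y = \<beta> y * \<alpha> y'"
        using C by (simp_all add: F_def single)
      moreover have "(\<alpha> x * \<beta> y) * (\<alpha> y' * \<beta> x')
          \<le> (\<gamma> (sup x y) * \<delta> (inf x y)) * (\<gamma> (sup x' y') * \<delta> (inf x' y'))"
        using nonneg le[of y' x']
        by (intro mult_mono[OF le]) (simp_all add: sup_commute inf_commute)
      ultimately show ?thesis by (simp add: mult_ac)
    qed
  qed (auto intro: F_nonneg nonneg)
  then have "(sum (F \<alpha> \<beta>) UNIV)\<^sup>2 \<le> (sum (F \<gamma> \<delta>) UNIV)\<^sup>2"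
    by (simp add: swap[of \<beta> \<alpha>] swap[of \<delta> \<gamma>] power2_eq_square)
  then have "sum (F \<alpha> \<beta>) UNIV \<le> sum (F \<gamma> \<delta>) UNIV"
    by (rule power2_le_imp_le) (auto intro!: sum_nonneg F_nonneg nonneg)
  then show ?thesis by (simp only: first)
qed

section \<open>Coefficients of the generating polynomials\<close>

definition exponent :: "('l::finite \<Rightarrow> 'a \<Rightarrow> nat) \<Rightarrow> 'a \<Rightarrow> ('l \<Rightarrow>\<^sub>0 nat)" where
  "exponent r x = (\<Sum>i\<in>UNIV. Poly_Mapping.single i (r i x))"

lemma exponent_modular:
  assumes "\<And>i. modular_fun (r i)"
  shows "exponent r x + exponent r y = exponent r (sup x y) + exponent r (inf x y)"
  using assms
  by (simp add: exponent_def modular_fun_def sum.distrib[symmetric] single_add[symmetric])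

lemma qvar_power: "qvar i ^ n = Poly_Mapping.single (Poly_Mapping.single i n) 1"
  by (induction n) (simp_all add: qvar_def mult_single single_add[symmetric])

lemma q_sum_eq:
  "q_sum r \<rho> X = (\<Sum>x\<in>X. Poly_Mapping.single (exponent r x) (\<rho> x))"
proof -
  have "(\<Prod>i\<in>I. qvar i ^ r i x)
      = Poly_Mapping.single (\<Sum>i\<in>I. Poly_Mapping.single i (r i x)) 1" if "finite I" for I x
    using that by induction (simp_all add: qvar_power mult_single)
  then show ?thesis
    by (simp add: q_sum_def const_poly_def exponent_def mult_single)
qed

text \<open>
  Extending the coefficient functions by zero lets the pairs range over the whole lattice, which
  is the form that can be split according to join and meet.
\<close>

lemma lookup_q_sum_mult:
  "Poly_Mapping.lookup (q_sum r \<rho> X * q_sum r \<sigma> Y) m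
     = (\<Sum>(x, y) | exponent r x + exponent r y = m.
         (if x \<in> X then \<rho> x else 0) * (if y \<in> Y then \<sigma> y else 0))"
proof -
  let ?P = "\<lambda>x y. exponent r x + exponent r y = m"
  have "Poly_Mapping.lookup (q_sum r \<rho> X * q_sum r \<sigma> Y) m
      = (\<Sum>(x, y)\<in>X \<times> Y. if ?P x y then \<rho> x * \<sigma> y else 0)"
    by (simp add: q_sum_eq sum_product mult_single lookup_sum lookup_single when_def
        flip: sum.cartesian_product)
  also have "\<dots> = (\<Sum>(x, y) | ?P x y.
         (if x \<in> X then \<rho> x else 0) * (if y \<in> Y then \<sigma> y else 0))"
    by (rule sum.mono_neutral_cong) (auto split: if_splits)
  finally show ?thesis .
qed

theorem theorem6p1:
  fixes r :: "'l::finite \<Rightarrow> 'a::{finite, distrib_lattice} \<Rightarrow> nat"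
    and \<alpha> \<beta> \<gamma> \<delta> :: "'a \<Rightarrow> real"
    and X Y :: "'a set"
  assumes "\<And>i. modular_fun (r i)"
    and "\<And>x. 0 \<le> \<alpha> x" and "\<And>x. 0 \<le> \<beta> x" and "\<And>x. 0 \<le> \<gamma> x" and "\<And>x. 0 \<le> \<delta> x"
    and "\<And>x y. \<alpha> x * \<beta> y \<le> \<gamma> (sup x y) * \<delta> (inf x y)"
  shows "q_sum r \<alpha> X * q_sum r \<beta> Y \<le>\<^sub>q q_sum r \<gamma> (set_sup X Y) * q_sum r \<delta> (set_inf X Y)"
proof -
  define a where "a x = (if x \<in> X then \<alpha> x else 0)" for x
  define b where "b x = (if x \<in> Y then \<beta> x else 0)" for x
  define c where "c x = (if x \<in> set_sup X Y then \<gamma> x else 0)" for x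
  define d where "d x = (if x \<in> set_inf X Y then \<delta> x else 0)" for x
  have nonneg: "0 \<le> a x" "0 \<le> b x" "0 \<le> c x" "0 \<le> d x" for x
    using assms(2-5) by (simp_all add: a_def b_def c_def d_def)
  have le: "a x * b y \<le> c (sup x y) * d (inf x y)" for x y
  proof (cases "x \<in> X \<and> y \<in> Y")
    case True
    then have "sup x y \<in> set_sup X Y" "inf x y \<in> set_inf X Y"
      by (auto simp: set_sup_def set_inf_def)
    then show ?thesis
      using True assms(6) by (simp add: a_def b_def c_def d_def)
  next
    case False
    then have "a x * b y = 0" by (auto simp: a_def b_def)
    also have "0 \<le> c (sup x y) * d (inf x y)"
      using nonneg by simp
    finally show ?thesis .
  qed
  have "Poly_Mapping.lookup (q_sum r \<alpha> X * q_sum r \<beta> Y) m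
      \<le> Poly_Mapping.lookup (q_sum r \<gamma> (set_sup X Y) * q_sum r \<delta> (set_inf X Y)) m" for m
  proof -
    define P where "P = {(x, y). exponent r x + exponent r y = m}"
    \<comment> \<open>By modularity the pairs in \<open>P\<close> are a union of classes with fixed join and meet, and the
      pairs \<open>(u, v)\<close> of joins and meets that occur lie in \<open>P\<close> themselves.\<close>
    have split: "(\<Sum>(x, y)\<in>P. \<rho> x * \<sigma> y)
        = (\<Sum>(u, v)\<in>P. \<Sum>(x, y) | sup x y = u \<and> inf x y = v. \<rho> x * \<sigma> y)"
      for \<rho> \<sigma> :: "'a \<Rightarrow> real"
    proof -
      let ?g = "\<lambda>(x, y). (sup x y, inf x y)"
      have g: "?g p \<in> P \<longleftrightarrow> p \<in> P" for p :: "'a \<times> 'a"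
        by (cases p) (simp add: P_def exponent_modular[of r, OF assms(1), symmetric])
      have "(\<Sum>(x, y)\<in>P. \<rho> x * \<sigma> y) = (\<Sum>uv\<in>P. \<Sum>(x, y) | (x, y) \<in> P \<and> ?g (x, y) = uv. \<rho> x * \<sigma> y)"
        using sum.group[of P P ?g "\<lambda>(x, y). \<rho> x * \<sigma> y"] g
        by (simp add: image_subset_iff split_def)
      also have "\<dots> = (\<Sum>(u, v)\<in>P. \<Sum>(x, y) | sup x y = u \<and> inf x y = v. \<rho> x * \<sigma> y)"
      proof (rule sum.cong[OF refl])
        fix uv assume "uv \<in> P"
        then have "{(x, y). (x, y) \<in> P \<and> ?g (x, y) = uv} = {(x, y). ?g (x, y) = uv}"
          using g by blast
        then show "(\<Sum>(x, y) | (x, y) \<in> P \<and> ?g (x, y) = uv. \<rho> x * \<sigma> y)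
            = (case uv of (u, v) \<Rightarrow> \<Sum>(x, y) | sup x y = u \<and> inf x y = v. \<rho> x * \<sigma> y)"
          by (cases uv) simp
      qed
      finally show ?thesis .
    qed
    have "(\<Sum>(x, y)\<in>P. a x * b y) \<le> (\<Sum>(x, y)\<in>P. c x * d y)"
      unfolding split
      using four_functions_relative_complements[of a b c d, OF nonneg le]
      by (intro sum_mono) auto
    then show ?thesis
      by (simp add: lookup_q_sum_mult P_def a_def b_def c_def d_def)
  qed
  then show ?thesis
    by (simp add: coeff_le_def lookup_minus)
qed

end
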